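(* Let $\mu\subseteq\lambda$ be partitions such that $\lambda/\mu$ has $n$ cells, and let $N\geq n$. Then \[ Q_{\lambda/\mu}(x_1,\ldots,x_N;t)=\sum_{S^*\in\mathrm{SYT}^{*Q}(\lambda/\mu)}\operatorname{sgn}(S^* )\,t^{\operatorname{tstat}(S^* )}\,F_{\operatorname{QAsc}'(S^* )}(x_1,\ldots,x_N). \]
   Context: $t$ is an indeterminate. Skew diagrams $\lambda/\mu=\{(i,j):\mu_i<j\le\lambda_i\}$ (matrix coordinates); $\mu/(0)$ is the diagram of $\mu$. Semistandard tableaux $T$ of shape $\lambda/\mu$ with entries in $[N]$ are weakly increasing along rows and strictly down columns, $x^T=\prod_c x_{T(c)}$; standard tableaux are semistandard bijections onto $[n]$. For such $T$, a cell $(i,j)$ is special if $j>1$ and no $(u,j-1)\in\lambda/\mu$ has $T((u,j-1))=T((i,j))$, with weight $|\{(u,j-1)\in\lambda/\mu:u\ge i,\ T((u,j-1))<T((i,j))\}|+|\{(u,j-1)\in\mu/(0):u\ge i\}|$; the skew Hall–Littlewood polynomial is $P_{\lambda/\mu}(x_1,\ldots,x_N;t)=\sum_T\prod_{c\text{ special}}(1-t^{\mathrm{wt}(c)})x^T$ over semistandard $T$. Let $\phi_r(t)=(1-t)(1-t^2)\cdots(1-t^r)$, $b_\lambda(t)=\prod_{i\ge1}\phi_{m_i(\lambda)}(t)$ where $m_i(\lambda)$ is the number of parts of $\lambda$ equal to $i$, $b_{\lambda/\mu}=b_\lambda/b_\mu$, and $Q_{\lambda/\mu}=b_{\lambda/\mu}(t)P_{\lambda/\mu}$.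 For a standard tableau $S$ of shape $\lambda/\mu$, every cell is $Q$-special, and the $Q$-weight of a cell $(i,j)$ is $\mathrm{wt}((i,j))=i-|\{u:(u,j+1)\in\mu/(0)\text{ or } S((u,j+1))\le S((i,j))\}|$. A $Q$-starred standard tableau is a pair $S^*=(S,E)$ with $S$ standard of shape $\lambda/\mu$ and $E\subseteq\lambda/\mu$ arbitrary; $\mathrm{SYT}^{*Q}(\lambda/\mu)$ is the set of these, $\operatorname{sgn}(S^* )=(-1)^{|E|}$, $\operatorname{tstat}(S^* )=\sum_{c\in E}\mathrm{wt}(c)$ ($Q$-weights). $\operatorname{QAsc}(S^* )$ is the set of $k<n$ such that either (a) $k+1$ appears in a lower row of $S$ than $k$, or (b) the cell containing $k$ lies in $E$ and $k+1$ appears in the column immediately to the right of the column containing $k$. For $T=\{t_1<\dots<t_m\}\subseteq[n-1]$, $\mathrm{comp}(T)=(t_1,t_2-t_1,\ldots,n-t_m)$; $\operatorname{QAsc}'(S^* )=\mathrm{comp}(\operatorname{QAsc}(S^* ))$. For a composition $\alpha$ of $n$ with partial-sum set $\mathrm{sub}(\alpha)$, $F_\alpha(x_1,\ldots,x_N)=\sum x_{w_1}\cdots x_{w_n}$ over $1\le w_1\le\dots\le w_n\le N$ with $w_j<w_{j+1}$ for $j\in\mathrm{sub}(\alpha)$. *)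

theory Defs
  imports
    "HOL-Library.Poly_Mapping"
    "HOL-Library.FuncSet"
    "HOL-Computational_Algebra.Computational_Algebra"
begin

(* Coefficients live in Q(t), since b_lambda / b_mu is in general only a rational function of t.
   A multivariate polynomial is a finitely supported map from monomials to coefficients, a monomial
   being a finitely supported exponent map; the variables in use are x_1, ..., x_N. *)

type_synonym qt = "rat poly fract"
type_synonym mvpoly = "(nat \<Rightarrow>\<^sub>0 nat) \<Rightarrow>\<^sub>0 qt"

definition tt :: qt where
  "tt = to_fract [:0, 1:]"

definition cst :: "qt \<Rightarrow> mvpoly" where
  "cst c = Poly_Mapping.single 0 c"

definition var :: "nat \<Rightarrow> mvpoly" where
  "var i = Poly_Mapping.single (Poly_Mapping.single i 1) 1"

(* A partition is the list of its positive parts; part extends it by zeros and is 1-based. *)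

definition is_partition :: "nat list \<Rightarrow> bool" where
  "is_partition la \<longleftrightarrow> sorted_wrt (\<ge>) la \<and> 0 \<notin> set la"

definition part :: "nat list \<Rightarrow> nat \<Rightarrow> nat" where
  "part la i = (if 1 \<le> i \<and> i \<le> length la then la ! (i - 1) else 0)"

definition skew :: "nat list \<Rightarrow> nat list \<Rightarrow> (nat \<times> nat) set" where
  "skew la mu = {(i, j). 1 \<le> i \<and> part mu i < j \<and> j \<le> part la i}"

abbreviation diagram :: "nat list \<Rightarrow> (nat \<times> nat) set" where
  "diagram mu \<equiv> skew mu []"

(* Fillings are extensional (undefined off the shape), so that each tableau is counted once. *)

definition ssyt :: "(nat \<times> nat) set \<Rightarrow> nat \<Rightarrow> (nat \<times> nat \<Rightarrow> nat) set" where
  "ssyt D N = {T \<in> D \<rightarrow>\<^sub>E {1..N}.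
     (\<forall>i j j'. (i, j) \<in> D \<and> (i, j') \<in> D \<and> j < j' \<longrightarrow> T (i, j) \<le> T (i, j')) \<and>
     (\<forall>i i' j. (i, j) \<in> D \<and> (i', j) \<in> D \<and> i < i' \<longrightarrow> T (i, j) < T (i', j))}"

definition syt :: "(nat \<times> nat) set \<Rightarrow> (nat \<times> nat \<Rightarrow> nat) set" where
  "syt D = {S \<in> ssyt D (card D). bij_betw S D {1..card D}}"

definition special :: "nat list \<Rightarrow> nat list \<Rightarrow> (nat \<times> nat \<Rightarrow> nat) \<Rightarrow> (nat \<times> nat) set" where
  "special la mu T = {(i, j) \<in> skew la mu. j > 1 \<and>
     \<not> (\<exists>u. (u, j - 1) \<in> skew la mu \<and> T (u, j - 1) = T (i, j))}"

fun wtP :: "nat list \<Rightarrow> nat list \<Rightarrow> (nat \<times> nat \<Rightarrow> nat) \<Rightarrow> nat \<times> nat \<Rightarrow> nat" where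
  "wtP la mu T (i, j) =
     card {u. (u, j - 1) \<in> skew la mu \<and> u \<ge> i \<and> T (u, j - 1) < T (i, j)}
     + card {u. (u, j - 1) \<in> diagram mu \<and> u \<ge> i}"

definition skewP :: "nat \<Rightarrow> nat list \<Rightarrow> nat list \<Rightarrow> mvpoly" where
  "skewP N la mu = (\<Sum>T \<in> ssyt (skew la mu) N.
     cst (\<Prod>c \<in> special la mu T. 1 - tt ^ wtP la mu T c) * (\<Prod>c \<in> skew la mu. var (T c)))"

definition phi :: "nat \<Rightarrow> qt" where
  "phi r = (\<Prod>k = 1..r. 1 - tt ^ k)"

(* Values i that are not parts have multiplicity 0 and would contribute the factor phi 0 = 1. *)

definition bcoef :: "nat list \<Rightarrow> qt" where
  "bcoef la = (\<Prod>i \<in> set la. phi (count_list la i))"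

definition skewQ :: "nat \<Rightarrow> nat list \<Rightarrow> nat list \<Rightarrow> mvpoly" where
  "skewQ N la mu = cst (bcoef la / bcoef mu) * skewP N la mu"

(* The subtraction on nat does not truncate when S is standard: every row u counted here
   satisfies u < i. *)

fun wtQ :: "nat list \<Rightarrow> nat list \<Rightarrow> (nat \<times> nat \<Rightarrow> nat) \<Rightarrow> nat \<times> nat \<Rightarrow> nat" where
  "wtQ la mu S (i, j) =
     i - card {u. (u, j + 1) \<in> diagram mu \<or>
                  ((u, j + 1) \<in> skew la mu \<and> S (u, j + 1) \<le> S (i, j))}"

definition SYTQ :: "nat list \<Rightarrow> nat list \<Rightarrow> ((nat \<times> nat \<Rightarrow> nat) \<times> (nat \<times> nat) set) set" where
  "SYTQ la mu = {(S, E). S \<in> syt (skew la mu) \<and> E \<subseteq> skew la mu}"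

definition sgnQ :: "(nat \<times> nat \<Rightarrow> nat) \<times> (nat \<times> nat) set \<Rightarrow> qt" where
  "sgnQ SE = (-1) ^ card (snd SE)"

definition tstat :: "nat list \<Rightarrow> nat list \<Rightarrow> (nat \<times> nat \<Rightarrow> nat) \<times> (nat \<times> nat) set \<Rightarrow> nat" where
  "tstat la mu SE = (\<Sum>c \<in> snd SE. wtQ la mu (fst SE) c)"

definition QAsc :: "nat list \<Rightarrow> nat list \<Rightarrow> (nat \<times> nat \<Rightarrow> nat) \<times> (nat \<times> nat) set \<Rightarrow> nat set" where
  "QAsc la mu SE = (case SE of (S, E) \<Rightarrow>
     {k \<in> {1..<card (skew la mu)}.
        \<exists>c \<in> skew la mu. \<exists>d \<in> skew la mu. S c = k \<and> S d = k + 1 \<and>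
          (fst c < fst d \<or> (c \<in> E \<and> snd d = snd c + 1))})"

(* comp n {t_1 < ... < t_m} = [t_1, t_2 - t_1, ..., n - t_m]; the composition of 0 is empty. *)

definition comp :: "nat \<Rightarrow> nat set \<Rightarrow> nat list" where
  "comp n A = (if n = 0 then [] else
     (let ts = sorted_list_of_set A in map2 (-) (ts @ [n]) (0 # ts)))"

definition sub :: "nat list \<Rightarrow> nat set" where
  "sub \<alpha> = {sum_list (take k \<alpha>) | k. 1 \<le> k \<and> k < length \<alpha>}"

definition QAsc' :: "nat list \<Rightarrow> nat list \<Rightarrow> (nat \<times> nat \<Rightarrow> nat) \<times> (nat \<times> nat) set \<Rightarrow> nat list" where
  "QAsc' la mu SE = comp (card (skew la mu)) (QAsc la mu SE)"

definition fundF :: "nat \<Rightarrow> nat list \<Rightarrow> mvpoly" where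
  "fundF N \<alpha> = (\<Sum>w \<in> {w \<in> {1..sum_list \<alpha>} \<rightarrow>\<^sub>E {1..N}.
        mono_on {1..sum_list \<alpha>} w \<and> (\<forall>j \<in> sub \<alpha>. w j < w (j + 1))}.
     \<Prod>j = 1..sum_list \<alpha>. var (w j))"

end

theory Submission
  imports Defs
begin

text \<open>
  A semistandard tableau \<open>T\<close> is a chain of partitions, each obtained from the previous one by adding
  a horizontal strip. Adding a strip changes the multiplicity \<open>m\<^sub>j\<close> only if it meets exactly one of the
  columns \<open>j\<close>, \<open>j + 1\<close>, and then by one; so \<open>\<phi>\<close> of the multiplicity is multiplied or divided by a
  single factor \<open>1 - t^m\<close>. These factors are the weights of the \<open>Q\<close>-special cells (multiplied)
  and of the special cells (divided), whence
  \<open>b\<^sub>\<lambda> / b\<^sub>\<mu> \<Prod> (1 - t^wt) = \<Prod> (1 - t^wtQ)\<close> for every single \<open>T\<close>.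

  On the other side, a standard tableau \<open>S\<close> together with a word \<open>w\<close> counted by \<open>F\<close> is the same as
  the semistandard tableau \<open>T = w \<circ> S\<close>, with \<open>S\<close> recovered by ordering the cells by their entry and
  then by their column. For fixed \<open>(S, w)\<close> the admissible sets \<open>E\<close> are the subsets of the set of
  \<open>Q\<close>-special cells of \<open>T\<close>, and the alternating sum over \<open>E\<close> expands \<open>\<Prod> (1 - t^wtQ)\<close>.
\<close>

section \<open>Skew shapes\<close>

lemma mem_diagram: "(i, j) \<in> diagram mu \<longleftrightarrow> 1 \<le> i \<and> 0 < j \<and> j \<le> part mu i"
  by (auto simp: skew_def part_def)

lemma part_antimono:
  assumes "is_partition la" "1 \<le> i" "i \<le> i'"
  shows "part la i' \<le> part la i"
proof (cases "i < i' \<and> i' \<le> length la")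
  case True
  then have "la ! (i' - 1) \<le> la ! (i - 1)"
    using assms sorted_wrt_nth_less[of "(\<ge>)" la "i - 1" "i' - 1"]
    by (auto simp: is_partition_def)
  with True assms show ?thesis by (auto simp: part_def)
next
  case False
  with assms show ?thesis by (cases "i = i'") (auto simp: part_def)
qed

lemma finite_skew: "finite (skew la mu)"
proof (rule finite_subset)
  show "skew la mu \<subseteq> Sigma {1..length la} (\<lambda>i. {1..part la i})"
    by (auto simp: skew_def part_def split: if_splits)
qed simp

text \<open>Row \<open>u\<close> meets column \<open>j\<close> but not column \<open>j + 1\<close>
  exactly when its length is \<open>j\<close>. Multiplicities thus become differences of column
  heights, which are easy to follow while cells are added.\<close>

lemma card_diagram_column_diff:
  assumes "1 \<le> j"
  shows "count_list la j =
    card {u. (u, j) \<in> diagram la} - card {u. (u, Suc j) \<in> diagram la}"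
proof -
  let ?C = "\<lambda>j. {u. (u, j) \<in> diagram la}"
  have fin: "finite (?C (Suc j))"
    by (rule finite_subset[of _ "{1..length la}"]) (auto simp: mem_diagram part_def split: if_splits)
  have sub: "?C (Suc j) \<subseteq> ?C j" using assms by (auto simp: mem_diagram)
  have "?C j - ?C (Suc j) = Suc ` {i. i < length la \<and> la ! i = j}"
  proof (intro set_eqI iffI)
    fix u assume "u \<in> ?C j - ?C (Suc j)"
    then have "1 \<le> u" "part la u = j" by (auto simp: mem_diagram)
    with assms show "u \<in> Suc ` {i. i < length la \<and> la ! i = j}"
      by (intro image_eqI[of _ _ "u - 1"]) (auto simp: part_def split: if_splits)
  qed (use assms in \<open>auto simp: mem_diagram part_def\<close>)
  then have "card (?C j - ?C (Suc j)) = card {i. i < length la \<and> la ! i = j}"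
    by (simp add: card_image)
  also have "\<dots> = count_list la j"
    by (simp add: count_list_eq_length_filter length_filter_conv_card eq_commute)
  finally show ?thesis using card_Diff_subset[OF fin sub] by simp
qed

section \<open>The factors \<open>phi\<close> and \<open>bcoef\<close>\<close>

lemma phi_Suc: "phi (Suc r) = phi r * (1 - tt ^ Suc r)"
  by (simp add: phi_def prod.nat_ivl_Suc')

lemma tt_power: "tt ^ k = to_fract (monom 1 k)"
proof (induction k)
  case (Suc k)
  have "monom (1::rat) (Suc k) = [:0, 1:] * monom 1 k" by (simp add: monom_Suc)
  then show ?case
    unfolding power_Suc Suc by (simp only: tt_def to_fract_mult)
qed simp

text \<open>Since t is an indeterminate, a positive power of t has positive degree and differs from
  1. This makes the division by \<open>bcoef mu\<close> harmless.\<close>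

lemma phi_nonzero: "phi r \<noteq> 0"
proof (induction r)
  case (Suc r)
  have "tt ^ Suc r \<noteq> 1"
  proof
    assume "tt ^ Suc r = 1"
    then have "to_fract (monom (1::rat) (Suc r)) = to_fract 1" by (simp only: tt_power to_fract_1)
    then have "monom (1::rat) (Suc r) = 1" by (simp only: to_fract_eq_iff)
    then have "degree (monom (1::rat) (Suc r)) = degree (1 :: rat poly)" by (rule arg_cong)
    then show False by (simp add: degree_monom_eq)
  qed
  with Suc show ?case by (simp only: phi_Suc mult_eq_0_iff) simp
qed (simp add: phi_def)

lemma bcoef_nonzero: "bcoef la \<noteq> 0"
  by (simp add: bcoef_def phi_nonzero)

text \<open>Values that are not parts contribute \<open>phi 0 = 1\<close>. The common index range
  lets \<open>la\<close> and \<open>mu\<close> be compared one \<open>j\<close> at a time.\<close>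

lemma bcoef_eq_prod:
  assumes "set la \<subseteq> {1..M}"
  shows "bcoef la = (\<Prod>j = 1..M. phi (count_list la j))"
  unfolding bcoef_def using assms
  by (intro prod.mono_neutral_left) (auto simp: phi_def count_list_0_iff)

section \<open>Semistandard fillings of a skew shape\<close>

lemma ssyt_row:
  "T \<in> ssyt D N \<Longrightarrow> (i, j) \<in> D \<Longrightarrow> (i, j') \<in> D \<Longrightarrow> j < j' \<Longrightarrow> T (i, j) \<le> T (i, j')"
  unfolding ssyt_def by blast

lemma ssyt_column:
  "T \<in> ssyt D N \<Longrightarrow> (i, j) \<in> D \<Longrightarrow> (i', j) \<in> D \<Longrightarrow> i < i' \<Longrightarrow> T (i, j) < T (i', j)"
  unfolding ssyt_def by blast

locale skew_shape =
  fixes la mu :: "nat list"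
  assumes la: "is_partition la" and mu: "is_partition mu"
    and contained: "diagram mu \<subseteq> diagram la"
begin

abbreviation D where "D \<equiv> skew la mu"

lemma mem_D: "(i, j) \<in> D \<longleftrightarrow> 1 \<le> i \<and> part mu i < j \<and> j \<le> part la i"
  by (simp add: skew_def)

lemma part_le: "part mu i \<le> part la i"
proof (cases "part mu i = 0")
  case False
  then have "(i, part mu i) \<in> diagram mu" by (auto simp: mem_diagram part_def split: if_splits)
  with contained have "(i, part mu i) \<in> diagram la" by blast
  then show ?thesis by (simp add: mem_diagram)
qed simp

text \<open>The corner lies weakly right of the first cell, hence outside \<open>mu\<close>, and
  weakly above the second, hence inside \<open>la\<close>. It allows cells to be compared by a path
  along a row and then down a column.\<close>

lemma D_convex:
  assumes "(i, j) \<in> D" "(i', j') \<in> D" "i \<le> i'" "j \<le> j'"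
  shows "(i, j') \<in> D"
  using assms part_antimono[OF la, of i i'] by (auto simp: mem_D)

lemma ssyt_le:
  assumes "T \<in> ssyt D N" "c \<in> D" "d \<in> D" "fst c \<le> fst d" "snd c \<le> snd d"
  shows "T c \<le> T d"
proof -
  obtain i j i' j' where cd: "c = (i, j)" "d = (i', j')" by (cases c, cases d) blast
  note cells = assms(2-5)[unfolded cd fst_conv snd_conv]
  have corner: "(i, j') \<in> D" using D_convex[OF cells] .
  have "T (i, j) \<le> T (i, j')"
    using ssyt_row[OF assms(1) cells(1) corner] cells(4) by (cases "j = j'") simp_all
  also have "\<dots> \<le> T (i', j')"
    using ssyt_column[OF assms(1) corner cells(2)] cells(3) by (cases "i = i'") simp_all
  finally show ?thesis unfolding cd .
qed

lemma ssyt_less: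
  assumes "T \<in> ssyt D N" "c \<in> D" "d \<in> D" "fst c < fst d" "snd c \<le> snd d"
  shows "T c < T d"
proof -
  obtain i j i' j' where cd: "c = (i, j)" "d = (i', j')" by (cases c, cases d) blast
  note cells = assms(2-5)[unfolded cd fst_conv snd_conv]
  have corner: "(i, j') \<in> D" using D_convex[OF cells(1,2)] cells(3,4) by simp
  have "T (i, j) \<le> T (i, j')"
    using ssyt_le[OF assms(1) cells(1) corner] cells(4) by simp
  also have "\<dots> < T (i', j')"
    using ssyt_column[OF assms(1) corner cells(2,3)] .
  finally show ?thesis unfolding cd .
qed

lemma ssyt_column_inj:
  assumes "T \<in> ssyt D N" "c \<in> D" "d \<in> D" "snd c = snd d" "T c = T d"
  shows "c = d"
  using ssyt_less[OF assms(1,2,3)] ssyt_less[OF assms(1,3,2)] assms(4,5)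
  by (metis less_irrefl linorder_neqE_nat order_refl prod_eqI)

lemma ssyt_range: "T \<in> ssyt D N \<Longrightarrow> c \<in> D \<Longrightarrow> 1 \<le> T c \<and> T c \<le> N"
  by (auto simp: ssyt_def PiE_iff)

end

section \<open>Comparing the weights of a semistandard tableau\<close>

text \<open>Mirror image of \<open>special\<close>: equal entries are sought in the column to the
  right, and no column is excluded. In a standard tableau every cell qualifies.\<close>

definition qspecial :: "(nat \<times> nat) set \<Rightarrow> (nat \<times> nat \<Rightarrow> nat) \<Rightarrow> (nat \<times> nat) set" where
  "qspecial D T = {(i, j) \<in> D. \<not> (\<exists>u. (u, j + 1) \<in> D \<and> T (u, j + 1) = T (i, j))}"

locale skew_tableau = skew_shape +
  fixes N :: nat and T :: "nat \<times> nat \<Rightarrow> nat"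
  assumes T: "T \<in> ssyt D N"
begin

text \<open>The tableau is a chain of partitions \<open>mu = la(0) \<subseteq> \<dots> \<subseteq> la(N) = la\<close>: the set \<open>col a j\<close> is
  column \<open>j\<close> of \<open>la(a)\<close>, and \<open>mult a j\<close> is the multiplicity of the part \<open>j\<close> in \<open>la(a)\<close>.\<close>

definition col :: "nat \<Rightarrow> nat \<Rightarrow> nat set" where
  "col a j = {u. (u, j) \<in> diagram mu \<or> ((u, j) \<in> D \<and> T (u, j) \<le> a)}"

definition mult :: "nat \<Rightarrow> nat \<Rightarrow> nat" where
  "mult a j = card (col a j) - card (col a (Suc j))"

text \<open>Says that the horizontal strip of entries \<open>a\<close> meets column
  \<open>j\<close>.\<close>

definition occ :: "nat \<Rightarrow> nat \<Rightarrow> bool" where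
  "occ a j \<longleftrightarrow> (\<exists>u. (u, j) \<in> D \<and> T (u, j) = a)"

lemma finite_col: "finite (col a j)"
proof (rule finite_subset)
  show "col a j \<subseteq> {1..length la} \<union> {1..length mu}"
    by (auto simp: col_def mem_D mem_diagram part_def split: if_splits)
qed simp

lemma col_Suc_subset: "1 \<le> j \<Longrightarrow> col a (Suc j) \<subseteq> col a j"
proof
  fix u assume "1 \<le> j" and u: "u \<in> col a (Suc j)"
  show "u \<in> col a j"
  proof (cases "j \<le> part mu u")
    case True
    with u \<open>1 \<le> j\<close> show ?thesis by (auto simp: col_def mem_diagram mem_D)
  next
    case False
    with u have "(u, Suc j) \<in> D" "T (u, Suc j) \<le> a" "(u, j) \<in> D"
      by (auto simp: col_def mem_diagram mem_D)
    with ssyt_le[OF T, of "(u, j)" "(u, Suc j)"] show ?thesis by (simp add: col_def)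
  qed
qed

text \<open>Ensures that the subtraction in \<open>mult\<close> does not truncate.\<close>

lemma card_col_Suc_le: "1 \<le> j \<Longrightarrow> card (col a (Suc j)) \<le> card (col a j)"
  by (simp add: card_mono finite_col col_Suc_subset)

text \<open>Above the cell, the column lies in \<open>mu\<close> or carries smaller entries; below
  it, only larger entries occur. Hence the row index \<open>i\<close> in \<open>wtQ\<close> is a
  column height.\<close>

lemma col_cell:
  assumes "(i, j) \<in> D"
  shows "col (T (i, j)) j = {1..i}"
proof (intro set_eqI iffI)
  fix u assume "u \<in> {1..i}"
  then have u: "1 \<le> u" "u \<le> i" by auto
  show "u \<in> col (T (i, j)) j"
  proof (cases "j \<le> part mu u")
    case True
    with u assms show ?thesis by (auto simp: col_def mem_diagram mem_D)
  next
    case False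
    have "part la i \<le> part la u" using part_antimono[OF la] u by simp
    with False u assms have "(u, j) \<in> D" by (auto simp: mem_D)
    with ssyt_le[OF T, of "(u, j)" "(i, j)"] u assms show ?thesis by (simp add: col_def)
  qed
next
  fix u assume u: "u \<in> col (T (i, j)) j"
  have "1 \<le> u" using u by (auto simp: col_def mem_diagram mem_D)
  moreover have "u \<le> i"
  proof (rule ccontr)
    assume "\<not> u \<le> i"
    then have "i < u" by simp
    then have "part mu u \<le> part mu i" using part_antimono[OF mu] assms by (simp add: mem_D)
    then have "(u, j) \<notin> diagram mu" using assms by (auto simp: mem_D mem_diagram)
    moreover have "(u, j) \<in> D \<Longrightarrow> T (i, j) < T (u, j)"
      using ssyt_less[OF T assms, of "(u, j)"] \<open>i < u\<close> by simp
    ultimately show False using u by (auto simp: col_def)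
  qed
  ultimately show "u \<in> {1..i}" by simp
qed

text \<open>Strictness down columns allows at most one new cell per column.\<close>

lemma card_col_step: "card (col (Suc a) j) = card (col a j) + of_bool (occ (Suc a) j)"
proof (cases "occ (Suc a) j")
  case True
  then obtain u where u: "(u, j) \<in> D" "T (u, j) = Suc a" by (auto simp: occ_def)
  have "v = u" if "(v, j) \<in> D" "T (v, j) = Suc a" for v
    using ssyt_column_inj[OF T that(1) u(1)] u that by simp
  with u have "col (Suc a) j = insert u (col a j)"
    unfolding col_def le_Suc_eq by blast
  moreover have "u \<notin> col a j" using u by (auto simp: col_def mem_D mem_diagram)
  ultimately show ?thesis using True by (simp add: finite_col)
next
  case False
  then have "col (Suc a) j = col a j" by (auto simp: col_def occ_def le_Suc_eq)
  with False show ?thesis by simp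
qed

text \<open>The multiplicity of \<open>j\<close> rises by one if the strip meets column
  \<open>j\<close> only, falls by one if it meets column \<open>j + 1\<close> only, and is unchanged
  otherwise. The exponent is the larger of the two multiplicities: the one after a rise, the one
  before a fall.\<close>

lemma phi_step:
  assumes "1 \<le> j"
  shows "phi (mult (Suc a) j) *
      (if \<not> occ (Suc a) j \<and> occ (Suc a) (Suc j) then 1 - tt ^ mult a j else 1) =
    phi (mult a j) *
      (if occ (Suc a) j \<and> \<not> occ (Suc a) (Suc j) then 1 - tt ^ mult (Suc a) j else 1)"
proof -
  note le = card_col_Suc_le[OF assms, of a] card_col_Suc_le[OF assms, of "Suc a"]
  consider (eq) "occ (Suc a) j = occ (Suc a) (Suc j)"
    | (up) "occ (Suc a) j" "\<not> occ (Suc a) (Suc j)"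
    | (down) "\<not> occ (Suc a) j" "occ (Suc a) (Suc j)" by blast
  then show ?thesis
  proof cases
    case eq
    then have "mult (Suc a) j = mult a j" by (simp add: mult_def card_col_step)
    with eq show ?thesis by simp
  next
    case up
    then have "mult (Suc a) j = Suc (mult a j)"
      using le by (simp add: mult_def card_col_step)
    with up show ?thesis by (simp add: phi_Suc)
  next
    case down
    then have "mult a j = Suc (mult (Suc a) j)"
      using le by (simp add: mult_def card_col_step)
    with down show ?thesis by (simp add: phi_Suc)
  qed
qed

lemma phi_telescope:
  assumes "1 \<le> j"
  shows "phi (mult n j) *
      (\<Prod>a = 1..n. if \<not> occ a j \<and> occ a (Suc j) then 1 - tt ^ mult (a - 1) j else 1) =
    phi (mult 0 j) *
      (\<Prod>a = 1..n. if occ a j \<and> \<not> occ a (Suc j) then 1 - tt ^ mult a j else 1)"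
    (is "phi (mult n j) * prod ?P _ = phi (mult 0 j) * prod ?Q _")
proof -
  define P Q where "P = ?P" and "Q = ?Q"
  have step: "phi (mult (Suc m) j) * P (Suc m) = phi (mult m j) * Q (Suc m)" for m
    using phi_step[OF assms, of m] by (simp only: P_def Q_def diff_Suc_1)
  have "phi (mult n j) * (\<Prod>a = 1..n. P a) = phi (mult 0 j) * (\<Prod>a = 1..n. Q a)"
  proof (induction n)
    case (Suc n)
    have "phi (mult (Suc n) j) * (\<Prod>a = 1..Suc n. P a) =
        (phi (mult (Suc n) j) * P (Suc n)) * (\<Prod>a = 1..n. P a)"
      by (simp add: prod.nat_ivl_Suc' mult_ac)
    also have "\<dots> = (phi (mult n j) * (\<Prod>a = 1..n. P a)) * Q (Suc n)"
      unfolding step by (simp only: mult_ac)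
    also have "\<dots> = phi (mult 0 j) * (\<Prod>a = 1..Suc n. Q a)"
      unfolding Suc.IH by (simp add: prod.nat_ivl_Suc' mult_ac)
    finally show ?case .
  qed simp
  then show ?thesis by (simp only: P_def Q_def)
qed

text \<open>Entries are at least 1, so the chain of partitions starts at \<open>mu\<close>.\<close>

lemma mult_0: "1 \<le> j \<Longrightarrow> mult 0 j = count_list mu j"
proof -
  have "col 0 j = {u. (u, j) \<in> diagram mu}" for j
    using ssyt_range[OF T] by (force simp: col_def)
  then show "1 \<le> j \<Longrightarrow> mult 0 j = count_list mu j"
    by (simp add: mult_def card_diagram_column_diff)
qed

lemma mult_N:
  assumes "1 \<le> j"
  shows "mult N j = count_list la j"
proof -
  have "col N j = {u. (u, j) \<in> diagram la}" if "1 \<le> j" for j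
    using that ssyt_range[OF T] part_le
    by (fastforce simp: col_def mem_diagram mem_D intro: order_trans)
  then show ?thesis
    using assms by (simp add: mult_def card_diagram_column_diff)
qed

text \<open>With \<open>a = T (i, j)\<close>, column \<open>j\<close> of the partition reached at
  \<open>a\<close> has height \<open>i\<close>, and the set subtracted in \<open>wtQ\<close> is
  \<open>col a (j + 1)\<close>.\<close>

lemma wtQ_eq_mult: "(i, j) \<in> D \<Longrightarrow> wtQ la mu T (i, j) = mult (T (i, j)) j"
  by (simp add: mult_def col_cell) (simp add: col_def)

text \<open>Just before the cell is added, its column consists of the \<open>i - 1\<close> rows
  above it. The weight counts the rows from \<open>i\<close> on in column \<open>j\<close> at that
  moment, which is the difference of the two heights.\<close>

lemma wtP_eq_mult:
  assumes "(i, Suc j) \<in> D" "1 \<le> j"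
  shows "wtP la mu T (i, Suc j) = mult (T (i, Suc j) - 1) j"
proof -
  obtain a where a: "T (i, Suc j) = Suc a"
    using ssyt_range[OF T assms(1)] by (cases "T (i, Suc j)") auto
  have cell: "col (Suc a) (Suc j) = {1..i}" using col_cell[OF assms(1)] a by simp
  have "i \<notin> col a (Suc j)" using assms a by (auto simp: col_def mem_D mem_diagram)
  moreover have "col a (Suc j) \<subseteq> {1..i}" unfolding cell[symmetric] by (auto simp: col_def)
  ultimately have "col a (Suc j) \<subseteq> {1..i} - {i}" by blast
  also have "\<dots> = {1..<i}" by auto
  finally have "col a (Suc j) \<subseteq> {1..<i}" .
  moreover have "card (col a (Suc j)) = i - 1"
  proof -
    have "occ (Suc a) (Suc j)" using assms a by (auto simp: occ_def)
    with card_col_step[of a "Suc j"] cell show ?thesis by simp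
  qed
  ultimately have below: "col a (Suc j) = {1..<i}"
    by (intro card_subset_eq) auto
  \<comment> \<open>The two sets counted by \<open>wtP\<close> split the part of column
    \<open>j\<close> in rows from \<open>i\<close> on into cells of the skew shape and cells of
    \<open>mu\<close>.\<close>
  have "{u. (u, j) \<in> D \<and> i \<le> u \<and> T (u, j) < Suc a} \<union> {u. (u, j) \<in> diagram mu \<and> i \<le> u}
      = col a j - {1..<i}"
    by (auto simp: col_def mem_D mem_diagram)
  moreover have "card ({u. (u, j) \<in> D \<and> i \<le> u \<and> T (u, j) < Suc a} \<union>
        {u. (u, j) \<in> diagram mu \<and> i \<le> u}) =
      card {u. (u, j) \<in> D \<and> i \<le> u \<and> T (u, j) < Suc a} + card {u. (u, j) \<in> diagram mu \<and> i \<le> u}"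
  proof (rule card_Un_disjoint)
    show "finite {u. (u, j) \<in> D \<and> i \<le> u \<and> T (u, j) < Suc a}"
      by (rule finite_subset[OF _ finite_col[of a j]]) (auto simp: col_def)
    show "finite {u. (u, j) \<in> diagram mu \<and> i \<le> u}"
      by (rule finite_subset[OF _ finite_col[of a j]]) (auto simp: col_def)
  qed (auto simp: mem_D mem_diagram)
  moreover have "card (col a j - {1..<i}) = card (col a j) - card (col a (Suc j))"
    using card_Diff_subset[OF finite_col col_Suc_subset[OF assms(2)], of a] below by simp
  ultimately show ?thesis by (simp add: a mult_def)
qed

section \<open>Special and Q-special cells indexed by column and entry\<close>

lemma qspecial_prod:
  assumes M: "\<And>i. part la i \<le> M"
  shows "(\<Prod>c \<in> qspecial D T. 1 - tt ^ wtQ la mu T c) =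
    (\<Prod>j = 1..M. \<Prod>a = 1..N. if occ a j \<and> \<not> occ a (Suc j) then 1 - tt ^ mult a j else 1)"
proof -
  let ?A = "{(j, a) \<in> {1..M} \<times> {1..N}. occ a j \<and> \<not> occ a (Suc j)}"
  have "(\<Prod>j = 1..M. \<Prod>a = 1..N. if occ a j \<and> \<not> occ a (Suc j) then 1 - tt ^ mult a j else 1)
      = (\<Prod>p \<in> {1..M} \<times> {1..N}.
          if p \<in> ?A then 1 - tt ^ mult (snd p) (fst p) else 1)"
    unfolding prod.cartesian_product by (rule prod.cong) (auto split: if_splits)
  also have "\<dots> = (\<Prod>p \<in> ?A. 1 - tt ^ mult (snd p) (fst p))"
    by (intro prod.mono_neutral_cong_right) (auto split: if_splits)
  also have "\<dots> = (\<Prod>c \<in> qspecial D T. 1 - tt ^ wtQ la mu T c)"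
  \<comment> \<open>A cell is determined by its column and entry, since columns are strict.\<close>
  proof (rule prod.reindex_cong[of "\<lambda>c. (snd c, T c)"])
    show "inj_on (\<lambda>c. (snd c, T c)) (qspecial D T)"
      by (rule inj_onI) (auto simp: qspecial_def dest: ssyt_column_inj[OF T])
    show "?A = (\<lambda>c. (snd c, T c)) ` qspecial D T"
    proof (intro set_eqI iffI)
      fix p assume "p \<in> ?A"
      then obtain j a u where "p = (j, a)" "(u, j) \<in> D" "T (u, j) = a" "\<not> occ a (Suc j)"
        by (auto simp: occ_def)
      then show "p \<in> (\<lambda>c. (snd c, T c)) ` qspecial D T"
        by (intro image_eqI[of _ _ "(u, j)"]) (auto simp: qspecial_def occ_def)
    next
      fix p assume "p \<in> (\<lambda>c. (snd c, T c)) ` qspecial D T"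
      then obtain i j where p: "p = (j, T (i, j))" "(i, j) \<in> D"
        "\<not> (\<exists>u. (u, j + 1) \<in> D \<and> T (u, j + 1) = T (i, j))"
        by (auto simp: qspecial_def)
      moreover have "1 \<le> j" "j \<le> M" using p(2) M[of i] by (auto simp: mem_D)
      ultimately show "p \<in> ?A" using ssyt_range[OF T p(2)] by (auto simp: occ_def)
    qed
  qed (auto simp: qspecial_def wtQ_eq_mult simp del: wtQ.simps)
  finally show ?thesis by simp
qed

text \<open>A special cell in column \<open>j + 1\<close> is recorded under \<open>j\<close>,
  because adding it lowers the multiplicity of \<open>j\<close>. Its factor then belongs to the same
  \<open>j\<close> as in \<open>phi_telescope\<close>.\<close>

lemma special_prod:
  assumes M: "\<And>i. part la i \<le> M"
  shows "(\<Prod>c \<in> special la mu T. 1 - tt ^ wtP la mu T c) =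
    (\<Prod>j = 1..M. \<Prod>a = 1..N. if \<not> occ a j \<and> occ a (Suc j) then 1 - tt ^ mult (a - 1) j else 1)"
proof -
  let ?A = "{(j, a) \<in> {1..M} \<times> {1..N}. \<not> occ a j \<and> occ a (Suc j)}"
  let ?g = "\<lambda>c. (snd c - 1, T c)"
  have "(\<Prod>j = 1..M. \<Prod>a = 1..N. if \<not> occ a j \<and> occ a (Suc j) then 1 - tt ^ mult (a - 1) j else 1)
      = (\<Prod>p \<in> {1..M} \<times> {1..N}.
          if p \<in> ?A then 1 - tt ^ mult (snd p - 1) (fst p) else 1)"
    unfolding prod.cartesian_product by (rule prod.cong) (auto split: if_splits)
  also have "\<dots> = (\<Prod>p \<in> ?A. 1 - tt ^ mult (snd p - 1) (fst p))"
    by (intro prod.mono_neutral_cong_right) (auto split: if_splits)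
  also have "\<dots> = (\<Prod>c \<in> special la mu T. 1 - tt ^ wtP la mu T c)"
  proof (rule prod.reindex_cong[of ?g])
    show "inj_on ?g (special la mu T)"
    proof (rule inj_onI)
      fix c d assume cd: "c \<in> special la mu T" "d \<in> special la mu T" "?g c = ?g d"
      \<comment> \<open>Special cells have column greater than 1, so the predecessor on natural
        numbers is injective here.\<close>
      then have "snd c = snd d" by (auto simp: special_def)
      moreover have "c \<in> D" "d \<in> D" "T c = T d" using cd by (auto simp: special_def)
      ultimately show "c = d" by (intro ssyt_column_inj[OF T])
    qed
    show "?A = ?g ` special la mu T"
    proof (intro set_eqI iffI)
      fix p assume "p \<in> ?A"
      then obtain j a u where "p = (j, a)" "1 \<le> j" "(u, Suc j) \<in> D" "T (u, Suc j) = a"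
        "\<not> occ a j"
        by (auto simp: occ_def)
      then show "p \<in> ?g ` special la mu T"
        by (intro image_eqI[of _ _ "(u, Suc j)"]) (auto simp: special_def occ_def)
    next
      fix p assume "p \<in> ?g ` special la mu T"
      then obtain i j where p: "p = (j - 1, T (i, j))" "(i, j) \<in> D" "1 < j"
        "\<not> (\<exists>u. (u, j - 1) \<in> D \<and> T (u, j - 1) = T (i, j))"
        by (auto simp: special_def)
      moreover have "1 \<le> j - 1" "j - 1 \<le> M" using p(2,3) M[of i] by (auto simp: mem_D)
      ultimately show "p \<in> ?A" using ssyt_range[OF T p(2)] by (auto simp: occ_def)
    qed
    fix c assume "c \<in> special la mu T"
    then obtain i j where "c = (i, Suc j)" "(i, Suc j) \<in> D" "1 \<le> j"
      by (cases c, cases "snd c") (auto simp: special_def)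
    then show "1 - tt ^ mult (snd (?g c) - 1) (fst (?g c)) = 1 - tt ^ wtP la mu T c"
      by (simp add: wtP_eq_mult del: wtP.simps)
  qed
  finally show ?thesis by simp
qed

lemma bcoef_special_qspecial:
  "bcoef la * (\<Prod>c \<in> special la mu T. 1 - tt ^ wtP la mu T c) =
   bcoef mu * (\<Prod>c \<in> qspecial D T. 1 - tt ^ wtQ la mu T c)"
proof -
  \<comment> \<open>The largest part bounds all columns; the extra 0 keeps the set nonempty when
    \<open>la\<close> is empty.\<close>
  define M where "M = Max (set (0 # la))"
  have part_M: "part la i \<le> M" for i by (auto simp: part_def M_def)
  have set_part: "\<exists>i. x = part xs i" if "x \<in> set xs" for x xs
  proof -
    from that obtain k where "k < length xs" "x = xs ! k" by (auto simp: in_set_conv_nth)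
    then show ?thesis by (intro exI[of _ "Suc k"]) (simp add: part_def)
  qed
  have "set la \<subseteq> {1..M}"
  proof
    fix x assume "x \<in> set la"
    then have "x \<noteq> 0" "x \<le> M"
      using la set_part[of x la] part_M unfolding is_partition_def by metis+
    then show "x \<in> {1..M}" by simp
  qed
  moreover have "set mu \<subseteq> {1..M}"
  proof
    fix x assume "x \<in> set mu"
    then have "x \<noteq> 0" "x \<le> M"
      using mu set_part[of x mu] order_trans[OF part_le part_M] unfolding is_partition_def by metis+
    then show "x \<in> {1..M}" by simp
  qed
  ultimately have "bcoef la = (\<Prod>j = 1..M. phi (mult N j))" "bcoef mu = (\<Prod>j = 1..M. phi (mult 0 j))"
    by (simp_all add: bcoef_eq_prod mult_0 mult_N)
  then show ?thesis
    unfolding special_prod[OF part_M] qspecial_prod[OF part_M]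
    by (simp only: prod.distrib[symmetric]) (rule prod.cong[OF refl], simp only: phi_telescope atLeastAtMost_iff)
qed

end

section \<open>Fundamental quasisymmetric polynomials of ascent sets\<close>

text \<open>The differences telescope; sortedness keeps the natural subtraction exact.\<close>

lemma sum_list_take_differences:
  fixes a :: nat
  assumes "sorted (a # xs)" "k \<le> length xs"
  shows "a + sum_list (take k (map2 (-) xs (a # xs))) = (a # xs) ! k"
  using assms
proof (induction xs arbitrary: a k)
  case (Cons x xs)
  show ?case
  proof (cases k)
    case (Suc k')
    with Cons.prems have "a + (x - a) = x" "sorted (x # xs)" "k' \<le> length xs" by auto
    with Cons.IH[of x k'] Suc show ?thesis by (simp flip: add.assoc)
  qed simp
qed simp

lemma
  assumes "A \<subseteq> {1..<n}"
  shows sum_list_comp: "sum_list (comp n A) = n" and sub_comp: "sub (comp n A) = A"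
proof -
  have "sum_list (comp n A) = n \<and> sub (comp n A) = A"
  proof (cases "n = 0")
    case True
    with assms show ?thesis by (simp add: comp_def sub_def)
  next
    case False
    define ts where "ts = sorted_list_of_set A"
    have "finite A" using assms finite_subset by blast
    then have ts: "set ts = A" "sorted ts" by (simp_all add: ts_def)
    \<comment> \<open>The list \<open>0 # xs\<close> consists of all partial sums of the
      composition; \<open>sub\<close> omits the first one, 0, and the last one,
      \<open>n\<close>.\<close>
    define xs where "xs = ts @ [n]"
    have comp: "comp n A = map2 (-) xs (0 # xs)"
      using False by (simp add: comp_def ts_def[symmetric] xs_def zip_append2[of _ "0 # ts" "[n]", simplified])
    have "sorted (0 # xs)" using ts assms by (auto simp: xs_def sorted_append)
    then have take: "sum_list (take k (comp n A)) = (0 # xs) ! k" if "k \<le> length xs" for k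
      using sum_list_take_differences[of 0 xs k] that by (simp add: comp)
    have len: "length (comp n A) = length xs" by (simp add: comp)
    have "sum_list (comp n A) = n"
      using take[of "length xs"] len by (simp add: xs_def nth_append)
    moreover have "sub (comp n A) = A"
    proof -
      have "sub (comp n A) = {(0 # xs) ! k | k. 1 \<le> k \<and> k < length xs}"
        unfolding sub_def len by (rule Collect_cong) (metis take less_imp_le)
      also have "\<dots> = {ts ! k | k. k < length ts}"
      proof (intro set_eqI iffI)
        fix x assume "x \<in> {(0 # xs) ! k | k. 1 \<le> k \<and> k < length xs}"
        then obtain k where "x = (0 # xs) ! k" "1 \<le> k" "k < length xs" by blast
        then show "x \<in> {ts ! k | k. k < length ts}"
          by (cases k) (auto simp: xs_def nth_append)
      next
        fix x assume "x \<in> {ts ! k | k. k < length ts}"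
        then obtain k where "x = ts ! k" "k < length ts" by blast
        then show "x \<in> {(0 # xs) ! k | k. 1 \<le> k \<and> k < length xs}"
          by (intro CollectI exI[of _ "Suc k"]) (simp add: xs_def nth_append)
      qed
      also have "\<dots> = A" using ts(1) by (simp add: set_conv_nth)
      finally show ?thesis .
    qed
    ultimately show ?thesis ..
  qed
  then show "sum_list (comp n A) = n" "sub (comp n A) = A" by simp_all
qed

text \<open>Index set of \<open>fundF\<close>, with the strict ascents given as a set so that the
  conditions from rows and from stars can be separated.\<close>

definition words :: "nat \<Rightarrow> nat \<Rightarrow> nat set \<Rightarrow> (nat \<Rightarrow> nat) set" where
  "words n N A =
    {w \<in> {1..n} \<rightarrow>\<^sub>E {1..N}. mono_on {1..n} w \<and> (\<forall>j \<in> A. w j < w (j + 1))}"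

lemma finite_words: "finite (words n N A)"
  by (rule finite_subset[of _ "{1..n} \<rightarrow>\<^sub>E {1..N}"]) (auto simp: words_def intro: finite_PiE)

lemma fundF_comp:
  assumes "A \<subseteq> {1..<n}"
  shows "fundF N (comp n A) = (\<Sum>w \<in> words n N A. \<Prod>j = 1..n. var (w j))"
  by (simp add: fundF_def words_def sum_list_comp[OF assms] sub_comp[OF assms])

lemma finite_ssyt: "finite D \<Longrightarrow> finite (ssyt D N)"
  by (rule finite_subset[of _ "D \<rightarrow>\<^sub>E {1..N}"]) (auto simp: ssyt_def intro: finite_PiE)

lemma finite_syt: "finite D \<Longrightarrow> finite (syt D)"
  by (simp add: syt_def finite_ssyt)

lemma cst_mult: "cst (a * b) = cst a * cst b"
  by (simp add: cst_def mult_single)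

lemma cst_sum: "cst (sum f A) = (\<Sum>x \<in> A. cst (f x))"
  by (induction A rule: infinite_finite_induct) (simp_all add: cst_def single_add)

section \<open>Summing over the starred sets\<close>

context skew_shape
begin

text \<open>The ascents of the first kind in \<open>QAsc\<close>, which do not depend on the
  stars.\<close>

definition rowasc :: "(nat \<times> nat \<Rightarrow> nat) \<Rightarrow> nat set" where
  "rowasc S = {k \<in> {1..<card D}. \<exists>c \<in> D. \<exists>d \<in> D. S c = k \<and> S d = k + 1 \<and> fst c < fst d}"

text \<open>The cells whose star does not force a strict ascent of \<open>w\<close>.\<close>

definition unforced :: "(nat \<times> nat \<Rightarrow> nat) \<Rightarrow> (nat \<Rightarrow> nat) \<Rightarrow> (nat \<times> nat) set" where
  "unforced S w =
    {c \<in> D. \<not> (\<exists>d \<in> D. S d = S c + 1 \<and> snd d = snd c + 1 \<and> w (S d) = w (S c))}"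

lemma syt_ssyt: "S \<in> syt D \<Longrightarrow> S \<in> ssyt D (card D)"
  by (simp add: syt_def)

lemma syt_bij: "S \<in> syt D \<Longrightarrow> bij_betw S D {1..card D}"
  by (simp add: syt_def)

lemma syt_range: "S \<in> syt D \<Longrightarrow> c \<in> D \<Longrightarrow> 1 \<le> S c \<and> S c \<le> card D"
  using ssyt_range[OF syt_ssyt] .

lemma syt_inj: "S \<in> syt D \<Longrightarrow> c \<in> D \<Longrightarrow> d \<in> D \<Longrightarrow> S c = S d \<Longrightarrow> c = d"
  using bij_betw_imp_inj_on[OF syt_bij] by (blast dest: inj_onD)

lemma syt_surj:
  assumes "S \<in> syt D" "k \<in> {1..card D}"
  shows "\<exists>c \<in> D. S c = k"
  using assms(2) unfolding bij_betw_imp_surj_on[OF syt_bij[OF assms(1)], symmetric] by (auto simp only:)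

lemma words_mono:
  assumes "w \<in> words n N A" "1 \<le> k" "k \<le> l" "l \<le> n"
  shows "w k \<le> w l"
  using assms unfolding words_def by (auto intro: mono_onD)

text \<open>A star on \<open>c\<close> demands strictness after \<open>S c\<close> exactly when the
  next label is in the next column. As \<open>w\<close> is weakly increasing, this only excludes
  equality, so it becomes a condition on each starred cell separately.\<close>

lemma words_QAsc:
  assumes S: "S \<in> syt D" and "E \<subseteq> D"
  shows "w \<in> words (card D) N (QAsc la mu (S, E)) \<longleftrightarrow>
    w \<in> words (card D) N (rowasc S) \<and> E \<subseteq> unforced S w"
proof (intro iffI conjI)
  assume w: "w \<in> words (card D) N (QAsc la mu (S, E))"
  have "rowasc S \<subseteq> QAsc la mu (S, E)" by (auto simp: rowasc_def QAsc_def)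
  then show "w \<in> words (card D) N (rowasc S)" using w by (auto simp: words_def)
  show "E \<subseteq> unforced S w"
  proof
    fix c assume c: "c \<in> E"
    have "w (S d) \<noteq> w (S c)" if "d \<in> D" "S d = S c + 1" "snd d = snd c + 1" for d
    proof -
      have "c \<in> D" using c \<open>E \<subseteq> D\<close> by blast
      then have "S c \<in> {1..<card D}"
        using syt_range[OF S, of c] syt_range[OF S that(1)] that(2) by simp
      then have "S c \<in> QAsc la mu (S, E)"
        unfolding QAsc_def prod.case using \<open>c \<in> D\<close> that c by blast
      then have "w (S c) < w (S c + 1)" using w unfolding words_def by blast
      then show ?thesis by (simp add: that)
    qed
    then show "c \<in> unforced S w" using c \<open>E \<subseteq> D\<close> unfolding unforced_def by blast
  qed
next
  assume *: "w \<in> words (card D) N (rowasc S) \<and> E \<subseteq> unforced S w"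
  have "w k < w (k + 1)" if "k \<in> QAsc la mu (S, E)" for k
  proof -
    from that obtain c d where cd: "c \<in> D" "d \<in> D" "S c = k" "S d = k + 1" "1 \<le> k" "k < card D"
      "fst c < fst d \<or> (c \<in> E \<and> snd d = snd c + 1)"
      by (auto simp: QAsc_def)
    from cd(7) show ?thesis
    proof
      assume "fst c < fst d"
      with cd have "k \<in> rowasc S" unfolding rowasc_def by auto
      with * show ?thesis by (auto simp: words_def)
    next
      assume "c \<in> E \<and> snd d = snd c + 1"
      then have "w (k + 1) \<noteq> w k" using * cd unfolding unforced_def by auto
      moreover have "w k \<le> w (k + 1)" using * cd by (auto intro: words_mono)
      ultimately show ?thesis by simp
    qed
  qed
  with * show "w \<in> words (card D) N (QAsc la mu (S, E))" by (auto simp: words_def)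
qed

text \<open>Expanding the product, \<open>E\<close> records the factors from which the power of t is
  chosen instead of 1.\<close>

lemma sum_signs:
  assumes "finite F"
  shows "(\<Sum>E \<in> Pow F. sgnQ (S, E) * tt ^ tstat la mu (S, E)) =
    (\<Prod>c \<in> F. 1 - tt ^ wtQ la mu S c)"
proof -
  have "(\<Prod>c \<in> F. 1 - tt ^ wtQ la mu S c) = (\<Prod>c \<in> F. - (tt ^ wtQ la mu S c) + 1)"
    by simp
  also have "\<dots> = (\<Sum>E \<in> Pow F. \<Prod>c \<in> E. - (tt ^ wtQ la mu S c))"
    by (subst prod_add[OF assms]) simp
  also have "\<dots> = (\<Sum>E \<in> Pow F. sgnQ (S, E) * tt ^ tstat la mu (S, E))"
    by (simp add: sgnQ_def tstat_def power_sum prod_uminus)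
  finally show ?thesis by simp
qed

lemma sum_SYTQ:
  "(\<Sum>SE \<in> SYTQ la mu. cst (sgnQ SE * tt ^ tstat la mu SE) * fundF N (QAsc' la mu SE)) =
   (\<Sum>S \<in> syt D. \<Sum>w \<in> words (card D) N (rowasc S).
      cst (\<Prod>c \<in> unforced S w. 1 - tt ^ wtQ la mu S c) * (\<Prod>j = 1..card D. var (w j)))"
proof -
  let ?a = "\<lambda>SE. cst (sgnQ SE * tt ^ tstat la mu SE)"
  let ?X = "\<lambda>w. \<Prod>j = 1..card D. var (w j)"
  have "SYTQ la mu = Sigma (syt D) (\<lambda>_. Pow D)" by (auto simp: SYTQ_def)
  then have "(\<Sum>SE \<in> SYTQ la mu. ?a SE * fundF N (QAsc' la mu SE)) =
      (\<Sum>S \<in> syt D. \<Sum>E \<in> Pow D. ?a (S, E) * fundF N (QAsc' la mu (S, E)))"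
    by (simp add: sum.Sigma finite_syt finite_skew)
  also have "\<dots> = (\<Sum>S \<in> syt D. \<Sum>w \<in> words (card D) N (rowasc S).
      cst (\<Prod>c \<in> unforced S w. 1 - tt ^ wtQ la mu S c) * ?X w)"
  proof (rule sum.cong[OF refl])
    fix S assume S: "S \<in> syt D"
    let ?W = "words (card D) N (rowasc S)"
    have "fundF N (QAsc' la mu (S, E)) = (\<Sum>w \<in> {w \<in> ?W. E \<subseteq> unforced S w}. ?X w)"
      if "E \<in> Pow D" for E
    proof -
      have "QAsc la mu (S, E) \<subseteq> {1..<card D}" by (auto simp: QAsc_def)
      moreover have "words (card D) N (QAsc la mu (S, E)) = {w \<in> ?W. E \<subseteq> unforced S w}"
        using words_QAsc[OF S] that by blast
      ultimately show ?thesis by (simp add: QAsc'_def fundF_comp)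
    qed
    then have "(\<Sum>E \<in> Pow D. ?a (S, E) * fundF N (QAsc' la mu (S, E))) =
        (\<Sum>E \<in> Pow D. \<Sum>w \<in> {w \<in> ?W. E \<subseteq> unforced S w}. ?a (S, E) * ?X w)"
      by (simp add: sum_distrib_left)
    \<comment> \<open>With \<open>w\<close> fixed first, \<open>E\<close> runs through all subsets
      of \<open>unforced S w\<close>, and the signed sum factors.\<close>
    also have "\<dots> = (\<Sum>w \<in> ?W. \<Sum>E \<in> {E \<in> Pow D. E \<subseteq> unforced S w}. ?a (S, E) * ?X w)"
      by (rule sum.swap_restrict) (simp_all add: finite_skew finite_words)
    also have "\<dots> = (\<Sum>w \<in> ?W. cst (\<Prod>c \<in> unforced S w. 1 - tt ^ wtQ la mu S c) * ?X w)"
    proof (rule sum.cong[OF refl])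
      fix w
      have fin: "finite (unforced S w)"
        by (rule finite_subset[OF _ finite_skew]) (auto simp: unforced_def)
      have "{E \<in> Pow D. E \<subseteq> unforced S w} = Pow (unforced S w)" by (auto simp: unforced_def)
      then have "(\<Sum>E \<in> {E \<in> Pow D. E \<subseteq> unforced S w}. ?a (S, E) * ?X w) =
          (\<Sum>E \<in> Pow (unforced S w). ?a (S, E)) * ?X w"
        by (simp add: sum_distrib_right)
      also have "(\<Sum>E \<in> Pow (unforced S w). ?a (S, E)) =
          cst (\<Prod>c \<in> unforced S w. 1 - tt ^ wtQ la mu S c)"
        by (simp only: cst_sum[symmetric] sum_signs[OF fin])
      finally show "(\<Sum>E \<in> {E \<in> Pow D. E \<subseteq> unforced S w}. ?a (S, E) * ?X w) =
          cst (\<Prod>c \<in> unforced S w. 1 - tt ^ wtQ la mu S c) * ?X w" .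
    qed
    finally show "(\<Sum>E \<in> Pow D. ?a (S, E) * fundF N (QAsc' la mu (S, E))) =
        (\<Sum>w \<in> ?W. cst (\<Prod>c \<in> unforced S w. 1 - tt ^ wtQ la mu S c) * ?X w)" .
  qed
  finally show ?thesis .
qed

section \<open>Standardization\<close>

text \<open>The standardization order: by entry, ties from left to right. For semistandard
  \<open>T\<close> it is total on \<open>D\<close>, since equal entries lie in distinct
  columns.\<close>

definition tless :: "(nat \<times> nat \<Rightarrow> nat) \<Rightarrow> nat \<times> nat \<Rightarrow> nat \<times> nat \<Rightarrow> bool" where
  "tless T c d \<longleftrightarrow> T c < T d \<or> (T c = T d \<and> snd c < snd d)"

text \<open>The rank of a cell in the order \<open>tless T\<close>; the cell counts itself, so ranks
  start at 1.\<close>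

definition standardize :: "(nat \<times> nat \<Rightarrow> nat) \<Rightarrow> nat \<times> nat \<Rightarrow> nat" where
  "standardize T = (\<lambda>c \<in> D. card {d \<in> D. \<not> tless T c d})"

definition relabel :: "(nat \<times> nat \<Rightarrow> nat) \<times> (nat \<Rightarrow> nat) \<Rightarrow> nat \<times> nat \<Rightarrow> nat" where
  "relabel Sw = (\<lambda>c \<in> D. snd Sw (fst Sw c))"

lemma tless_between:
  "tless T c d \<Longrightarrow> tless T d e \<Longrightarrow> T c = T e \<Longrightarrow> snd c < snd d \<and> snd d < snd e"
  by (auto simp: tless_def)

text \<open>Equality of \<open>w\<close> means that \<open>S c\<close> is no row ascent, so
  \<open>d\<close> is weakly above \<open>c\<close>. Were it also weakly to the left, its label
  could not be larger.\<close>

lemma equal_label_step: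
  assumes S: "S \<in> syt D" and w: "w \<in> words (card D) N (rowasc S)"
    and cd: "c \<in> D" "d \<in> D" "S d = S c + 1" "w (S d) = w (S c)"
  shows "snd c < snd d"
proof (rule ccontr)
  assume "\<not> snd c < snd d"
  have "S c \<notin> rowasc S" using w cd(3,4) by (force simp: words_def)
  moreover have "1 \<le> S c" "S c < card D"
    using syt_range[OF S cd(1)] syt_range[OF S cd(2)] cd(3) by auto
  ultimately have "fst d \<le> fst c" using cd unfolding rowasc_def by force
  with \<open>\<not> snd c < snd d\<close> have "S d \<le> S c"
    using ssyt_le[OF syt_ssyt[OF S] cd(2,1)] by simp
  with cd(3) show False by simp
qed

text \<open>Being monotone, \<open>w\<close> is constant on all labels from \<open>S c\<close> to
  \<open>S d\<close>, so each single step in between moves right.\<close>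

lemma equal_label_columns:
  assumes S: "S \<in> syt D" and w: "w \<in> words (card D) N (rowasc S)"
    and c: "c \<in> D"
  shows "d \<in> D \<Longrightarrow> S c < S d \<Longrightarrow> w (S c) = w (S d) \<Longrightarrow> snd c < snd d"
proof (induction "S d" arbitrary: d rule: less_induct)
  case less
  show ?case
  proof (cases "S d = S c + 1")
    case True
    then show ?thesis using equal_label_step[OF S w c less.prems(1)] less.prems(3) by simp
  next
    case False
    have bounds: "1 \<le> S c" "S d \<le> card D"
      using syt_range[OF S c] syt_range[OF S less.prems(1)] by auto
    then have "S d - 1 \<in> {1..card D}" using less.prems(2) bounds by simp arith
    then obtain e where e: "e \<in> D" "S e = S d - 1" using syt_surj[OF S] by blast
    then have less_e: "S c < S e" "S e < S d" "S d = S e + 1" using False less.prems(2) by auto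
    have "w (S c) \<le> w (S e)" "w (S e) \<le> w (S d)"
      using words_mono[OF w, of "S c" "S e"] words_mono[OF w, of "S e" "S d"] less_e bounds by auto
    then have "w (S c) = w (S e)" "w (S d) = w (S e)" using less.prems(3) by auto
    then show ?thesis
      using less.hyps[OF less_e(2) e(1) less_e(1)]
        equal_label_step[OF S w e(1) less.prems(1) less_e(3)] by simp
  qed
qed

text \<open>The labels of \<open>S\<close> are recovered from the order of the relabelled tableau.
  One implication suffices, because labels are distinct and \<open>tless\<close> is
  asymmetric.\<close>

lemma relabel_order:
  assumes S: "S \<in> syt D" and w: "w \<in> words (card D) N (rowasc S)"
    and cd: "c \<in> D" "d \<in> D"
  shows "S c < S d \<longleftrightarrow> tless (relabel (S, w)) c d"
proof -
  have *: "tless (relabel (S, w)) c d" if "c \<in> D" "d \<in> D" "S c < S d" for c d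
  proof -
    have "w (S c) \<le> w (S d)"
      using words_mono[OF w, of "S c" "S d"] syt_range[OF S that(1)] syt_range[OF S that(2)] that(3)
      by simp
    then show ?thesis
      using equal_label_columns[OF S w that(1,2,3)] that by (auto simp: tless_def relabel_def)
  qed
  show ?thesis
  proof
    assume t: "tless (relabel (S, w)) c d"
    then have "c \<noteq> d" by (auto simp: tless_def)
    then have "S c \<noteq> S d" using syt_inj[OF S] cd by blast
    moreover have "\<not> S d < S c" using *[OF cd(2,1)] t by (auto simp: tless_def)
    ultimately show "S c < S d" by simp
  qed (rule *[OF cd])
qed

lemma relabel_ssyt:
  assumes S: "S \<in> syt D" and w: "w \<in> words (card D) N (rowasc S)"
  shows "relabel (S, w) \<in> ssyt D N"
proof -
  let ?T = "relabel (S, w)"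
  have "?T \<in> D \<rightarrow>\<^sub>E {1..N}"
  proof
    fix c assume c: "c \<in> D"
    then have "S c \<in> {1..card D}" using syt_range[OF S] by auto
    with w c show "?T c \<in> {1..N}" unfolding words_def by (auto simp: relabel_def)
  qed (simp add: relabel_def)
  moreover have "?T (i, j) \<le> ?T (i, j')" if "(i, j) \<in> D" "(i, j') \<in> D" "j < j'" for i j j'
  proof -
    have "S (i, j) \<le> S (i, j')" using ssyt_row[OF syt_ssyt[OF S] that] .
    then show ?thesis
      using words_mono[OF w] syt_range[OF S that(1)] syt_range[OF S that(2)] that
      by (simp add: relabel_def)
  qed
  moreover have "?T (i, j) < ?T (i', j)" if "(i, j) \<in> D" "(i', j) \<in> D" "i < i'" for i i' j
  proof -
    have "S (i, j) < S (i', j)" using ssyt_column[OF syt_ssyt[OF S] that] .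
    then have "tless ?T (i, j) (i', j)" using relabel_order[OF S w that(1,2)] by simp
    then show ?thesis by (simp add: tless_def)
  qed
  ultimately show ?thesis unfolding ssyt_def by blast
qed

text \<open>The cells not after \<open>c\<close> are those with label at most \<open>S c\<close>,
  and there are \<open>S c\<close> of them.\<close>

lemma standardize_relabel:
  assumes S: "S \<in> syt D" and w: "w \<in> words (card D) N (rowasc S)"
  shows "standardize (relabel (S, w)) = S"
proof
  fix c
  show "standardize (relabel (S, w)) c = S c"
  proof (cases "c \<in> D")
    case True
    have "{d \<in> D. \<not> tless (relabel (S, w)) c d} = {d \<in> D. S d \<le> S c}"
      using relabel_order[OF S w True] by (auto simp: not_less[symmetric])
    moreover have "card {d \<in> D. S d \<le> S c} = card {1..S c}"
    proof (rule bij_betw_same_card[of S])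
      have "S ` {d \<in> D. S d \<le> S c} = {1..S c}"
      proof (intro set_eqI iffI)
        fix k assume k: "k \<in> {1..S c}"
        then have "k \<in> {1..card D}" using syt_range[OF S True] by simp
        then obtain d where "d \<in> D" "S d = k" using syt_surj[OF S] by blast
        with k show "k \<in> S ` {d \<in> D. S d \<le> S c}" by auto
      qed (use syt_range[OF S] in auto)
      then show "bij_betw S {d \<in> D. S d \<le> S c} {1..S c}"
        by (intro bij_betw_imageI inj_onI syt_inj[OF S]) simp_all
    qed
    ultimately show ?thesis using True by (simp add: standardize_def)
  next
    case False
    have "S \<in> extensional D" using syt_ssyt[OF S] by (simp add: ssyt_def PiE_iff)
    then have "S c = undefined" using False by (rule extensional_arb)
    with False show ?thesis by (simp add: standardize_def)
  qed
qed

section \<open>The standardization of a semistandard tableau\<close>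

lemma tless_trans: "tless T c d \<Longrightarrow> tless T d e \<Longrightarrow> tless T c e"
  by (auto simp: tless_def)

lemma tless_irrefl: "\<not> tless T c c"
  by (simp add: tless_def)

lemma tless_total:
  "T \<in> ssyt D N \<Longrightarrow> c \<in> D \<Longrightarrow> d \<in> D \<Longrightarrow> c \<noteq> d \<Longrightarrow> tless T c d \<or> tless T d c"
  unfolding tless_def using ssyt_column_inj by (meson linorder_neqE_nat)

text \<open>Everything not after \<open>c\<close> is not after \<open>d\<close>, and
  \<open>d\<close> itself is counted only for \<open>d\<close>.\<close>

lemma standardize_mono:
  assumes "c \<in> D" "d \<in> D" "tless T c d"
  shows "standardize T c < standardize T d"
proof -
  have "{e \<in> D. \<not> tless T c e} \<subset> {e \<in> D. \<not> tless T d e}"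
  proof
    show "{e \<in> D. \<not> tless T c e} \<subseteq> {e \<in> D. \<not> tless T d e}"
      using tless_trans[OF assms(3)] by blast
    show "{e \<in> D. \<not> tless T c e} \<noteq> {e \<in> D. \<not> tless T d e}"
      using assms tless_irrefl by blast
  qed
  then have "card {e \<in> D. \<not> tless T c e} < card {e \<in> D. \<not> tless T d e}"
    by (intro psubset_card_mono) (simp_all add: finite_skew)
  then show ?thesis using assms by (simp add: standardize_def)
qed

lemma standardize_order:
  assumes "T \<in> ssyt D N" "c \<in> D" "d \<in> D"
  shows "standardize T c < standardize T d \<longleftrightarrow> tless T c d"
  using standardize_mono[OF assms(2,3)] standardize_mono[OF assms(3,2)] tless_total[OF assms]
  by (metis less_asym less_irrefl)

lemma standardize_syt:
  assumes T: "T \<in> ssyt D N"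
  shows "standardize T \<in> syt D"
proof -
  let ?S = "standardize T"
  have range: "?S c \<in> {1..card D}" if "c \<in> D" for c
  proof -
    have "card {d \<in> D. \<not> tless T c d} \<le> card D" by (rule card_mono) (auto simp: finite_skew)
    moreover have "card {c} \<le> card {d \<in> D. \<not> tless T c d}"
      by (rule card_mono) (simp_all add: finite_skew that tless_irrefl)
    ultimately show ?thesis using that by (simp add: standardize_def)
  qed
  have "inj_on ?S D"
    using standardize_mono tless_total[OF T] by (metis inj_onI less_irrefl)
  moreover from this have "?S ` D = {1..card D}"
    using range by (intro card_subset_eq) (auto simp: card_image)
  ultimately have "bij_betw ?S D {1..card D}" by (simp add: bij_betw_def)
  moreover have "?S (i, j) \<le> ?S (i, j')" if "(i, j) \<in> D" "(i, j') \<in> D" "j < j'" for i j j'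
  proof -
    have "tless T (i, j) (i, j')" using ssyt_row[OF T that] that(3) by (auto simp: tless_def)
    from standardize_mono[OF that(1,2) this] show ?thesis by simp
  qed
  moreover have "?S (i, j) < ?S (i', j)" if "(i, j) \<in> D" "(i', j) \<in> D" "i < i'" for i i' j
    using standardize_mono[OF that(1,2), of T] ssyt_column[OF T that] by (simp add: tless_def)
  moreover have "?S \<in> D \<rightarrow>\<^sub>E {1..card D}"
    using range by (auto simp: standardize_def)
  ultimately show ?thesis unfolding syt_def ssyt_def by blast
qed

lemma relabel_surj:
  assumes T: "T \<in> ssyt D N"
  obtains w where "w \<in> words (card D) N (rowasc (standardize T))"
    "relabel (standardize T, w) = T"
proof
  let ?S = "standardize T"
  \<comment> \<open>The word lists the entries of \<open>T\<close> in the order of the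
    labels.\<close>
  let ?w = "\<lambda>k \<in> {1..card D}. T (inv_into D ?S k)"
  note S = standardize_syt[OF T]
  have w: "?w (?S c) = T c" if "c \<in> D" for c
    using syt_range[OF S that] that bij_betw_imp_inj_on[OF syt_bij[OF S]] by simp
  have "?w \<in> {1..card D} \<rightarrow>\<^sub>E {1..N}"
  proof
    fix k assume "k \<in> {1..card D}"
    then obtain c where c: "c \<in> D" "?S c = k" using syt_surj[OF S] by blast
    then show "?w k \<in> {1..N}" using w[OF c(1)] ssyt_range[OF T c(1)] by simp
  qed auto
  moreover have "mono_on {1..card D} ?w"
  proof (rule mono_onI)
    fix k l assume kl: "k \<in> {1..card D}" "l \<in> {1..card D}" "k \<le> l"
    obtain c where c: "c \<in> D" "?S c = k" using syt_surj[OF S kl(1)] by blast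
    obtain d where d: "d \<in> D" "?S d = l" using syt_surj[OF S kl(2)] by blast
    have "T c \<le> T d"
    proof (cases "k = l")
      case True
      with c d have "c = d" using syt_inj[OF S] by blast
      then show ?thesis by simp
    next
      case False
      with kl c d have "tless T c d" using standardize_order[OF T c(1) d(1)] by simp
      then show ?thesis by (auto simp: tless_def)
    qed
    then show "?w k \<le> ?w l" using w[OF c(1)] w[OF d(1)] c d by simp
  qed
  moreover have "?w k < ?w (k + 1)" if k: "k \<in> rowasc ?S" for k
  proof -
    from k obtain c d where cd: "c \<in> D" "d \<in> D" "?S c = k" "?S d = k + 1" "fst c < fst d"
      by (auto simp: rowasc_def)
    then have "tless T c d" using standardize_order[OF T cd(1,2)] by simp
    \<comment> \<open>A tie would put \<open>d\<close> strictly to the right of \<open>c\<close> as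
      well as below it, where entries are strictly larger.\<close>
    then have "T c < T d" using ssyt_less[OF T cd(1,2,5)] by (auto simp: tless_def)
    then show ?thesis using w[OF cd(1)] w[OF cd(2)] cd by simp
  qed
  ultimately show "?w \<in> words (card D) N (rowasc ?S)" unfolding words_def by blast
  have "T \<in> extensional D" using T by (simp add: ssyt_def PiE_iff)
  then show "relabel (?S, ?w) = T"
    using w by (intro extensionalityI[of _ D]) (auto simp: relabel_def)
qed

text \<open>Standardizing recovers \<open>S\<close>; then \<open>w\<close> is determined because
  \<open>S\<close> takes every label.\<close>

lemma bij_betw_relabel:
  "bij_betw relabel (Sigma (syt D) (\<lambda>S. words (card D) N (rowasc S))) (ssyt D N)"
proof (rule bij_betw_imageI)
  show "inj_on relabel (Sigma (syt D) (\<lambda>S. words (card D) N (rowasc S)))"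
  proof (rule inj_onI)
    fix p q assume pq: "p \<in> Sigma (syt D) (\<lambda>S. words (card D) N (rowasc S))"
      "q \<in> Sigma (syt D) (\<lambda>S. words (card D) N (rowasc S))" "relabel p = relabel q"
    obtain S w S' w' where p: "p = (S, w)" and q: "q = (S', w')" by fastforce
    have S: "S \<in> syt D" "S' \<in> syt D" and w: "w \<in> words (card D) N (rowasc S)"
      "w' \<in> words (card D) N (rowasc S')"
      using pq(1,2) by (auto simp: p q)
    have "S = S'"
      using standardize_relabel[OF S(1) w(1)] standardize_relabel[OF S(2) w(2)] pq(3)
      by (simp add: p q)
    have "w = w'"
    proof (rule extensionalityI)
      show "w \<in> extensional {1..card D}" "w' \<in> extensional {1..card D}"
        using w by (auto simp: words_def PiE_iff)
      fix k assume "k \<in> {1..card D}"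
      then obtain c where c: "c \<in> D" "S c = k" using syt_surj[OF S(1)] by blast
      have "relabel p c = relabel q c" using pq(3) by simp
      then show "w k = w' k" using c \<open>S = S'\<close> by (simp add: p q relabel_def)
    qed
    with \<open>S = S'\<close> show "p = q" by (simp add: p q)
  qed
  show "relabel ` Sigma (syt D) (\<lambda>S. words (card D) N (rowasc S)) = ssyt D N"
  proof (intro set_eqI iffI)
    fix T assume T: "T \<in> ssyt D N"
    obtain w where "w \<in> words (card D) N (rowasc (standardize T))" "relabel (standardize T, w) = T"
      using relabel_surj[OF T] .
    with standardize_syt[OF T] show "T \<in> relabel ` Sigma (syt D) (\<lambda>S. words (card D) N (rowasc S))"
      by (intro image_eqI[of _ _ "(standardize T, w)"]) auto
  qed (auto intro: relabel_ssyt)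
qed

section \<open>Transfer of the weights to semistandard tableaux\<close>

lemma unforced_eq_qspecial:
  assumes S: "S \<in> syt D" and w: "w \<in> words (card D) N (rowasc S)"
  shows "unforced S w = qspecial D (relabel (S, w))"
proof -
  let ?T = "relabel (S, w)"
  have T: "?T c = w (S c)" if "c \<in> D" for c using that by (simp add: relabel_def)
  have iff: "(\<exists>d \<in> D. S d = S (i, j) + 1 \<and> snd d = j + 1 \<and> w (S d) = w (S (i, j))) \<longleftrightarrow>
      (\<exists>u. (u, j + 1) \<in> D \<and> ?T (u, j + 1) = ?T (i, j))" if c: "(i, j) \<in> D" for i j
  proof
    assume "\<exists>d \<in> D. S d = S (i, j) + 1 \<and> snd d = j + 1 \<and> w (S d) = w (S (i, j))"
    then obtain u where "(u, j + 1) \<in> D" "w (S (u, j + 1)) = w (S (i, j))" by force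
    with c show "\<exists>u. (u, j + 1) \<in> D \<and> ?T (u, j + 1) = ?T (i, j)" by (auto simp: T)
  next
    assume "\<exists>u. (u, j + 1) \<in> D \<and> ?T (u, j + 1) = ?T (i, j)"
    then obtain u where u: "(u, j + 1) \<in> D" "?T (u, j + 1) = ?T (i, j)" by blast
    let ?d = "(u, j + 1)"
    have "tless ?T (i, j) ?d" using u by (simp add: tless_def)
    then have less: "S (i, j) < S ?d" using relabel_order[OF S w c u(1)] by simp
    \<comment> \<open>A cell with a label strictly in between would have the same entry and lie in a
      column strictly between \<open>j\<close> and \<open>j + 1\<close>.\<close>
    have "S ?d = S (i, j) + 1"
    proof (rule ccontr)
      assume ne: "S ?d \<noteq> S (i, j) + 1"
      have "S (i, j) + 1 \<in> {1..card D}" using less syt_range[OF S u(1)] by simp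
      from syt_surj[OF S this] obtain e where e: "e \<in> D" "S e = S (i, j) + 1" by blast
      have "S (i, j) < S e" "S e < S ?d" using e(2) less ne by linarith+
      note this[unfolded relabel_order[OF S w c e(1)] relabel_order[OF S w e(1) u(1)]]
      from tless_between[OF this] show False using u(2) by auto
    qed
    moreover have "w (S ?d) = w (S (i, j))" using u(2) T[OF u(1)] T[OF c] by simp
    ultimately show "\<exists>d \<in> D. S d = S (i, j) + 1 \<and> snd d = j + 1 \<and> w (S d) = w (S (i, j))"
      using u(1) by force
  qed
  show ?thesis
  proof (rule set_eqI)
    fix c :: "nat \<times> nat"
    obtain i j where c: "c = (i, j)" by (cases c)
    show "c \<in> unforced S w \<longleftrightarrow> c \<in> qspecial D ?T"
      using iff[of i j] unfolding c unforced_def qspecial_def mem_Collect_eq prod.case snd_conv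
      by blast
  qed
qed

text \<open>A Q-special cell has no tie in the next column, so comparing entries there is the same
  as comparing labels. A tied cell would be counted for the relabelled tableau but not for
  \<open>S\<close>.\<close>

lemma wtQ_relabel:
  assumes S: "S \<in> syt D" and w: "w \<in> words (card D) N (rowasc S)"
    and c: "c \<in> qspecial D (relabel (S, w))"
  shows "wtQ la mu (relabel (S, w)) c = wtQ la mu S c"
proof -
  let ?T = "relabel (S, w)"
  obtain i j where ij: "c = (i, j)" "(i, j) \<in> D"
    "\<And>u. (u, j + 1) \<in> D \<Longrightarrow> ?T (u, j + 1) \<noteq> ?T (i, j)"
    using c by (auto simp: qspecial_def)
  have "S (u, j + 1) \<le> S (i, j) \<longleftrightarrow> ?T (u, j + 1) \<le> ?T (i, j)" if u: "(u, j + 1) \<in> D" for u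
    using relabel_order[OF S w ij(2) u] ij(3)[OF u] by (auto simp: tless_def not_less[symmetric])
  then have "{u. (u, j + 1) \<in> diagram mu \<or> ((u, j + 1) \<in> D \<and> ?T (u, j + 1) \<le> ?T (i, j))} =
      {u. (u, j + 1) \<in> diagram mu \<or> ((u, j + 1) \<in> D \<and> S (u, j + 1) \<le> S (i, j))}"
    by blast
  then show ?thesis by (simp only: ij(1) wtQ.simps)
qed

lemma sum_SYTQ_ssyt:
  "(\<Sum>SE \<in> SYTQ la mu. cst (sgnQ SE * tt ^ tstat la mu SE) * fundF N (QAsc' la mu SE)) =
   (\<Sum>T \<in> ssyt D N. cst (\<Prod>c \<in> qspecial D T. 1 - tt ^ wtQ la mu T c) * (\<Prod>c \<in> D. var (T c)))"
proof -
  let ?P = "Sigma (syt D) (\<lambda>S. words (card D) N (rowasc S))"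
  let ?g = "\<lambda>T. cst (\<Prod>c \<in> qspecial D T. 1 - tt ^ wtQ la mu T c) * (\<Prod>c \<in> D. var (T c))"
  have "cst (\<Prod>c \<in> unforced S w. 1 - tt ^ wtQ la mu S c) * (\<Prod>j = 1..card D. var (w j)) =
      ?g (relabel (S, w))"
    if S: "S \<in> syt D" and w: "w \<in> words (card D) N (rowasc S)" for S w
  proof -
    have "(\<Prod>j = 1..card D. var (w j)) = (\<Prod>c \<in> D. var (w (S c)))"
      by (rule prod.reindex_bij_betw[OF syt_bij[OF S], symmetric])
    also have "\<dots> = (\<Prod>c \<in> D. var (relabel (S, w) c))"
      by (rule prod.cong) (auto simp: relabel_def)
    finally have X: "(\<Prod>j = 1..card D. var (w j)) = (\<Prod>c \<in> D. var (relabel (S, w) c))" .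
    have "(\<Prod>c \<in> unforced S w. 1 - tt ^ wtQ la mu S c) =
        (\<Prod>c \<in> qspecial D (relabel (S, w)). 1 - tt ^ wtQ la mu (relabel (S, w)) c)"
      by (rule prod.cong[OF unforced_eq_qspecial[OF S w]]) (simp only: wtQ_relabel[OF S w])
    with X show ?thesis by (simp only:)
  qed
  then have "(\<Sum>SE \<in> SYTQ la mu. cst (sgnQ SE * tt ^ tstat la mu SE) * fundF N (QAsc' la mu SE)) =
      (\<Sum>S \<in> syt D. \<Sum>w \<in> words (card D) N (rowasc S). ?g (relabel (S, w)))"
    unfolding sum_SYTQ by (intro sum.cong refl) blast
  also have "\<dots> = (\<Sum>(S, w) \<in> ?P. ?g (relabel (S, w)))"
    by (rule sum.Sigma) (simp_all add: finite_syt finite_skew finite_words)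
  also have "\<dots> = (\<Sum>p \<in> ?P. ?g (relabel p))"
    by (simp only: split_def prod.collapse)
  also have "\<dots> = (\<Sum>T \<in> ssyt D N. ?g T)"
    by (rule sum.reindex_bij_betw[OF bij_betw_relabel])
  finally show ?thesis .
qed

text \<open>The quotient \<open>bcoef la / bcoef mu\<close> does not depend on the tableau, so it is
  absorbed into each summand separately, turning special factors into Q-special ones.\<close>

lemma skewQ_eq_sum_ssyt:
  "skewQ N la mu =
   (\<Sum>T \<in> ssyt D N. cst (\<Prod>c \<in> qspecial D T. 1 - tt ^ wtQ la mu T c) * (\<Prod>c \<in> D. var (T c)))"
proof -
  have "bcoef la / bcoef mu * (\<Prod>c \<in> special la mu T. 1 - tt ^ wtP la mu T c) =
      (\<Prod>c \<in> qspecial D T. 1 - tt ^ wtQ la mu T c)" if "T \<in> ssyt D N" for T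
  proof -
    interpret skew_tableau la mu N T by unfold_locales (rule that)
    show ?thesis
      using bcoef_special_qspecial bcoef_nonzero[of mu]
      by (simp only: times_divide_eq_left nonzero_mult_div_cancel_left not_False_eq_True)
  qed
  then show ?thesis
    unfolding skewQ_def skewP_def sum_distrib_left mult.assoc[symmetric] cst_mult[symmetric]
    by (intro sum.cong refl) (simp only:)
qed

end

theorem theorem4p2:
  fixes la mu :: "nat list" and n N :: nat
  assumes "is_partition la" and "is_partition mu"
    and "diagram mu \<subseteq> diagram la"
    and "card (skew la mu) = n" and "N \<ge> n"
  shows "skewQ N la mu =
    (\<Sum>SE \<in> SYTQ la mu. cst (sgnQ SE * tt ^ tstat la mu SE) * fundF N (QAsc' la mu SE))"
proof -
  interpret skew_shape la mu by unfold_locales (rule assms)+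
  show ?thesis unfolding skewQ_eq_sum_ssyt sum_SYTQ_ssyt ..
qed

end
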